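(* Let $G$ be a connected graph of order $n\geq 3$. Then $G$ has exactly three distinct normalized Laplacian eigenvalues, one of which equals $1$, if and only if either $G\cong K_{s,n-s}$ for some $1\leq s\leq n-1$, or $G\cong K_{n_1,n_2,\ldots,n_r}$ with $n_1=n_2=\cdots=n_r=\frac{n}{r}$ and $3\leq r\leq n-1$.
   Context: $K_{n_1,\ldots,n_r}$ denotes the complete multipartite graph with $r$ parts of sizes $n_1,\ldots,n_r$. For a graph with adjacency matrix $A$ and diagonal degree matrix $D$ (no isolated vertices), the normalized Laplacian is $\mathcal{L}=I-D^{-1/2}AD^{-1/2}$, and its eigenvalues are the normalized Laplacian eigenvalues. *)

theory Defs
  imports Complex_Main
begin

definition simple_graph :: "'a set \<Rightarrow> ('a \<Rightarrow> 'a \<Rightarrow> bool) \<Rightarrow> bool" where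
  "simple_graph V E \<longleftrightarrow> finite V \<and>
     (\<forall>u v. E u v \<longrightarrow> u \<in> V \<and> v \<in> V \<and> u \<noteq> v \<and> E v u)"

definition connected_graph :: "'a set \<Rightarrow> ('a \<Rightarrow> 'a \<Rightarrow> bool) \<Rightarrow> bool" where
  "connected_graph V E \<longleftrightarrow> V \<noteq> {} \<and> (\<forall>u\<in>V. \<forall>v\<in>V. E\<^sup>*\<^sup>* u v)"

definition degree :: "'a set \<Rightarrow> ('a \<Rightarrow> 'a \<Rightarrow> bool) \<Rightarrow> 'a \<Rightarrow> nat" where
  "degree V E u = card {v \<in> V. E u v}"

text \<open>Normalized Laplacian I - D^(-1/2) A D^(-1/2), as a matrix indexed by V.\<close>
definition norm_laplacian :: "'a set \<Rightarrow> ('a \<Rightarrow> 'a \<Rightarrow> bool) \<Rightarrow> 'a \<Rightarrow> 'a \<Rightarrow> real" where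
  "norm_laplacian V E u v =
     (if u = v then 1 else 0) -
     (if E u v then 1 / sqrt (real (degree V E u) * real (degree V E v)) else 0)"

definition matrix_eigenvalues :: "'a set \<Rightarrow> ('a \<Rightarrow> 'a \<Rightarrow> real) \<Rightarrow> real set" where
  "matrix_eigenvalues V M = {\<mu>. \<exists>x. (\<exists>u\<in>V. x u \<noteq> 0) \<and>
       (\<forall>u\<in>V. (\<Sum>v\<in>V. M u v * x v) = \<mu> * x u)}"

definition norm_lap_eigenvalues :: "'a set \<Rightarrow> ('a \<Rightarrow> 'a \<Rightarrow> bool) \<Rightarrow> real set" where
  "norm_lap_eigenvalues V E = matrix_eigenvalues V (norm_laplacian V E)"

definition graph_iso :: "'a set \<Rightarrow> ('a \<Rightarrow> 'a \<Rightarrow> bool) \<Rightarrow> 'b set \<Rightarrow> ('b \<Rightarrow> 'b \<Rightarrow> bool) \<Rightarrow> bool" where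
  "graph_iso V E W F \<longleftrightarrow> (\<exists>f. bij_betw f V W \<and> (\<forall>u\<in>V. \<forall>v\<in>V. E u v \<longleftrightarrow> F (f u) (f v)))"

text \<open>Complete multipartite graph K_{ns 0, ..., ns (r-1)}: vertex (i,j) is the j-th
  vertex of part i.\<close>
definition kmp_vertices :: "nat \<Rightarrow> (nat \<Rightarrow> nat) \<Rightarrow> (nat \<times> nat) set" where
  "kmp_vertices r ns = {(i, j). i < r \<and> j < ns i}"

definition kmp_edges :: "nat \<Rightarrow> (nat \<Rightarrow> nat) \<Rightarrow> nat \<times> nat \<Rightarrow> nat \<times> nat \<Rightarrow> bool" where
  "kmp_edges r ns x y \<longleftrightarrow> x \<in> kmp_vertices r ns \<and> y \<in> kmp_vertices r ns \<and> fst x \<noteq> fst y"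

end

theory Submission
  imports Defs "HOL-Computational_Algebra.Fundamental_Theorem_Algebra"
begin

text \<open>
  Let \<open>L\<close> be the normalized Laplacian, with eigenvalues \<open>0, 1, \<theta>\<close>. A symmetric matrix is annihilated by
  every polynomial vanishing on its spectrum, so \<open>L (L - 1) (L - \<theta>) = 0\<close>. By connectedness the kernel
  of \<open>L\<close> is spanned by the vector with entries \<open>sqrt (d u)\<close>, hence the symmetric matrix
  \<open>(L - 1) (L - \<theta>)\<close> has entries \<open>c * sqrt (d u * d v)\<close>. Written out, the sum of \<open>1 / d w\<close> over the common
  neighbours \<open>w\<close> of \<open>u\<close> and \<open>v\<close> equals \<open>c * d u * d v\<close>, plus \<open>1 - \<theta>\<close> if \<open>u\<close> and \<open>v\<close> are adjacent, and
  the case \<open>u = v\<close> shows \<open>c > 0\<close>. For nonadjacent \<open>u, v\<close>, comparison with the cases \<open>(u, u)\<close> and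
  \<open>(v, v)\<close> forces equal neighbourhoods, so the graph is complete multipartite. For adjacent \<open>u, v\<close>
  inclusion-exclusion shows that \<open>d u ^ 2 + d v ^ 2 - d u * d v\<close> is constant, which makes all degrees
  equal once there are three parts.
\<close>

section \<open>Polynomials in a symmetric matrix\<close>

text \<open>Vectors are complex although the matrix is real: the eigenvalue found below is a root
  supplied by the fundamental theorem of algebra and is shown to be real only afterwards.\<close>

definition mat_op :: "'a set \<Rightarrow> ('a \<Rightarrow> 'a \<Rightarrow> real) \<Rightarrow> ('a \<Rightarrow> complex) \<Rightarrow> 'a \<Rightarrow> complex" where
  "mat_op V M x u = (\<Sum>v\<in>V. of_real (M u v) * x v)"

text \<open>Horner's scheme for p(M) x. Folding over the coefficients avoids matrix powers and suits
  induction over \<open>pCons\<close>.\<close>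

definition poly_op ::
  "'a set \<Rightarrow> ('a \<Rightarrow> 'a \<Rightarrow> real) \<Rightarrow> complex poly \<Rightarrow> ('a \<Rightarrow> complex) \<Rightarrow> 'a \<Rightarrow> complex" where
  "poly_op V M p x = fold_coeffs (\<lambda>a w u. a * x u + mat_op V M w u) p (\<lambda>_. 0)"

lemma mat_op_zero [simp]: "mat_op V M (\<lambda>_. 0) = (\<lambda>_. 0)"
  by (simp add: mat_op_def fun_eq_iff)

lemma mat_op_add: "mat_op V M (\<lambda>u. x u + y u) = (\<lambda>u. mat_op V M x u + mat_op V M y u)"
  by (simp add: mat_op_def fun_eq_iff algebra_simps sum.distrib)

lemma mat_op_scale: "mat_op V M (\<lambda>u. a * x u) = (\<lambda>u. a * mat_op V M x u)"
  by (simp add: mat_op_def fun_eq_iff sum_distrib_left algebra_simps)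

lemma poly_op_0 [simp]: "poly_op V M 0 x = (\<lambda>_. 0)"
  by (simp add: poly_op_def)

lemma poly_op_pCons [simp]:
  "poly_op V M (pCons a p) x = (\<lambda>u. a * x u + mat_op V M (poly_op V M p x) u)"
  by (cases "a = 0 \<and> p = 0") (auto simp: poly_op_def)

lemma poly_op_add: "poly_op V M (p + q) x = (\<lambda>u. poly_op V M p x u + poly_op V M q x u)"
proof (induction p arbitrary: q)
  case (pCons a p)
  show ?case
    by (cases q) (simp add: pCons.IH mat_op_add, simp add: algebra_simps)
qed simp

lemma poly_op_smult: "poly_op V M (smult c p) x = (\<lambda>u. c * poly_op V M p x u)"
  by (induction p) (simp_all add: mat_op_scale algebra_simps)

lemma poly_op_mat_op: "poly_op V M p (mat_op V M x) = mat_op V M (poly_op V M p x)"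
  by (induction p) (simp_all add: mat_op_add mat_op_scale)

lemma poly_op_mult: "poly_op V M (p * q) x = poly_op V M p (poly_op V M q x)"
  by (induction p) (simp_all add: poly_op_add poly_op_smult)

lemma poly_op_sum:
  "poly_op V M (\<Sum>i\<in>I. p i) x = (\<lambda>u. \<Sum>i\<in>I. poly_op V M (p i) x u)"
  by (induction I rule: infinite_finite_induct) (simp_all add: poly_op_add)

lemma poly_op_eigenvector:
  assumes "\<And>u. u \<in> V \<Longrightarrow> mat_op V M x u = c * x u" "u \<in> V"
  shows "poly_op V M p x u = poly p c * x u"
  using assms(2)
proof (induction p arbitrary: u)
  case (pCons a p)
  \<comment> \<open>The induction hypothesis holds on \<open>V\<close> only, which suffices because
    \<open>mat_op\<close> reads its argument only there.\<close>
  have "mat_op V M (poly_op V M p x) u = mat_op V M (\<lambda>u. poly p c * x u) u"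
    unfolding mat_op_def by (intro sum.cong) (simp_all add: pCons.IH)
  then show ?case
    using assms(1)[OF pCons.prems] by (simp add: mat_op_scale distrib_right)
qed simp

section \<open>Self-adjointness for the Hermitian form\<close>

lemma mat_op_selfadjoint:
  assumes "\<And>u v. u \<in> V \<Longrightarrow> v \<in> V \<Longrightarrow> M u v = M v u"
  shows "(\<Sum>u\<in>V. mat_op V M x u * cnj (y u)) = (\<Sum>u\<in>V. x u * cnj (mat_op V M y u))"
proof -
  have "(\<Sum>u\<in>V. mat_op V M x u * cnj (y u))
      = (\<Sum>u\<in>V. \<Sum>v\<in>V. of_real (M u v) * x v * cnj (y u))"
    by (simp add: mat_op_def sum_distrib_right)
  also have "\<dots> = (\<Sum>v\<in>V. \<Sum>u\<in>V. of_real (M u v) * x v * cnj (y u))"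
    by (rule sum.swap)
  also have "\<dots> = (\<Sum>v\<in>V. \<Sum>u\<in>V. x v * (of_real (M v u) * cnj (y u)))"
    by (intro sum.cong refl) (simp add: assms algebra_simps)
  finally show ?thesis
    by (simp add: mat_op_def sum_distrib_left)
qed

text \<open>Real coefficients are unchanged by conjugation, and one factor M is moved across at a
  time. The induction generalizes \<open>x\<close> because that factor is first absorbed into
  it.\<close>

lemma poly_op_selfadjoint:
  assumes "\<And>u v. u \<in> V \<Longrightarrow> v \<in> V \<Longrightarrow> M u v = M v u"
  shows "(\<Sum>u\<in>V. poly_op V M (map_poly of_real q) x u * cnj (y u))
       = (\<Sum>u\<in>V. x u * cnj (poly_op V M (map_poly of_real q) y u))"
proof (induction q arbitrary: x)
  case (pCons a q)
  let ?q = "map_poly of_real q :: complex poly"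
  have "(\<Sum>u\<in>V. mat_op V M (poly_op V M ?q x) u * cnj (y u))
      = (\<Sum>u\<in>V. poly_op V M ?q (mat_op V M x) u * cnj (y u))"
    by (simp add: poly_op_mat_op)
  also have "\<dots> = (\<Sum>u\<in>V. x u * cnj (mat_op V M (poly_op V M ?q y) u))"
    by (simp add: pCons.IH mat_op_selfadjoint[OF assms])
  finally show ?case
    using pCons.hyps by (simp add: map_poly_pCons algebra_simps sum.distrib)
qed simp

section \<open>Existence and reality of eigenvalues\<close>

lemma sum_mult_cnj_eq_zero:
  fixes x :: "'a \<Rightarrow> complex"
  assumes "finite V" "(\<Sum>u\<in>V. x u * cnj (x u)) = 0" "u \<in> V"
  shows "x u = 0"
proof -
  have "complex_of_real (\<Sum>u\<in>V. (cmod (x u))\<^sup>2) = 0"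
    using assms(2) by (simp flip: complex_norm_square)
  then have "(\<Sum>u\<in>V. (cmod (x u))\<^sup>2) = 0"
    using of_real_eq_0_iff by blast
  then show ?thesis
    using assms(1,3) by (simp add: sum_nonneg_eq_0_iff)
qed

text \<open>Gaussian elimination, one coordinate at a time: a vector \<open>f k\<close> with nonzero
  entry at \<open>a\<close> clears that entry from the others, and the induction hypothesis applies
  to the cleared vectors on the remaining coordinates.\<close>

lemma linear_dependence:
  fixes f :: "'i \<Rightarrow> 'a \<Rightarrow> 'b::field"
  assumes "finite V" "finite I" "card V < card I"
  shows "\<exists>c. (\<exists>i\<in>I. c i \<noteq> 0) \<and> (\<forall>v\<in>V. (\<Sum>i\<in>I. c i * f i v) = 0)"
  using assms
proof (induction V arbitrary: f I rule: finite_induct)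
  case empty
  then have "I \<noteq> {}" by auto
  then show ?case by (intro exI[of _ "\<lambda>_. 1"]) auto
next
  case (insert a V)
  show ?case
  proof (cases "\<forall>i\<in>I. f i a = 0")
    case True
    obtain c where "\<exists>i\<in>I. c i \<noteq> 0" "\<forall>v\<in>V. (\<Sum>i\<in>I. c i * f i v) = 0"
      using insert.IH[of I f] insert.prems insert.hyps by auto
    then show ?thesis
      using True by (intro exI[of _ c]) auto
  next
    case False
    then obtain k where k: "k \<in> I" "f k a \<noteq> 0" by auto
    define J where "J = I - {k}"
    define g where "g i v = f i v - f i a / f k a * f k v" for i v
    have J: "finite J" "card V < card J" "I = insert k J" "k \<notin> J"
      using insert.prems insert.hyps k by (auto simp: J_def)
    obtain c where c: "\<exists>i\<in>J. c i \<noteq> 0" "\<forall>v\<in>V. (\<Sum>i\<in>J. c i * g i v) = 0"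
      using insert.IH[of J g] J by auto
    \<comment> \<open>The coefficient of the pivot collects the multiples of \<open>f k\<close>
      subtracted in \<open>g\<close>, so both combinations agree.\<close>
    define d where "d = c(k := - (\<Sum>i\<in>J. c i * (f i a / f k a)))"
    have "(\<Sum>i\<in>I. d i * f i v) = (\<Sum>i\<in>J. c i * g i v)" for v
    proof -
      have "(\<Sum>i\<in>J. d i * f i v) = (\<Sum>i\<in>J. c i * f i v)"
        using J by (intro sum.cong) (auto simp: d_def)
      then show ?thesis
        using J by (simp add: d_def g_def sum_subtractf sum_distrib_left algebra_simps)
    qed
    moreover have "g i a = 0" for i
      using k by (simp add: g_def)
    moreover have "\<exists>i\<in>I. d i \<noteq> 0"
      using c(1) J by (auto simp: d_def)
    ultimately show ?thesis
      using c(2) by (intro exI[of _ d]) auto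
  qed
qed

text \<open>The vectors z, M z, ..., M^n z with n = \<open>card V\<close> are n + 1 vectors in
  dimension n, hence dependent.\<close>

lemma poly_op_annihilator_exists:
  assumes "finite V"
  shows "\<exists>p. p \<noteq> 0 \<and> (\<forall>u\<in>V. poly_op V M p z u = 0)"
proof -
  obtain c where c: "\<exists>i\<in>{..card V}. c i \<noteq> 0"
    "\<forall>v\<in>V. (\<Sum>i\<in>{..card V}. c i * poly_op V M (monom 1 i) z v) = 0"
    using linear_dependence[of V "{..card V}" "\<lambda>i. poly_op V M (monom 1 i) z"] assms by auto
  define p where "p = (\<Sum>i\<in>{..card V}. smult (c i) (monom 1 i))"
  have "coeff p i = c i" if "i \<le> card V" for i
    using that by (simp add: p_def coeff_sum if_distrib[of "\<lambda>x. _ * x"] sum.delta cong: if_cong)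
  then have "p \<noteq> 0"
    using c(1) by (metis atMost_iff coeff_0)
  moreover have "\<forall>u\<in>V. poly_op V M p z u = 0"
    using c(2) by (simp add: p_def poly_op_sum poly_op_smult)
  ultimately show ?thesis by blast
qed

text \<open>Take an annihilator p of z of least degree and split off a root, p = (X - c) g.
  Minimality keeps g(M) z nonzero, and M - c kills it. It matters later that the eigenvector is a
  polynomial in M applied to z.\<close>

lemma poly_op_orbit_eigenvector:
  assumes "finite V" "\<exists>u\<in>V. z u \<noteq> 0"
  shows "\<exists>g c. (\<exists>u\<in>V. poly_op V M g z u \<noteq> 0) \<and>
           (\<forall>u\<in>V. mat_op V M (poly_op V M g z) u = c * poly_op V M g z u)"
proof -
  let ?A = "\<lambda>p. p \<noteq> 0 \<and> (\<forall>u\<in>V. poly_op V M p z u = 0)"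
  obtain p where p: "?A p" and min: "\<And>g. ?A g \<Longrightarrow> Polynomial.degree p \<le> Polynomial.degree g"
    using ex_has_least_nat[of ?A _ Polynomial.degree] poly_op_annihilator_exists[OF assms(1)]
    by metis
  have "Polynomial.degree p \<noteq> 0"
  proof
    assume "Polynomial.degree p = 0"
    then obtain a where "p = [:a:]" by (auto elim: degree_eq_zeroE)
    then show False using p assms(2) by auto
  qed
  then have "\<not> constant (poly p)"
    by (simp add: constant_degree)
  then obtain c where "poly p c = 0"
    using fundamental_theorem_of_algebra by blast
  then obtain g where g: "p = [:- c, 1:] * g"
    by (auto simp: poly_eq_0_iff_dvd elim: dvdE)
  have "g \<noteq> 0" using p g by auto
  then have "Polynomial.degree p = Suc (Polynomial.degree g)"
    unfolding g by (subst degree_mult_eq) auto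
  then have "\<exists>u\<in>V. poly_op V M g z u \<noteq> 0"
    using min[of g] \<open>g \<noteq> 0\<close> by force
  moreover have "mat_op V M (poly_op V M g z) u = c * poly_op V M g z u" if "u \<in> V" for u
    using p that unfolding g poly_op_mult by (auto simp: mat_op_scale mat_op_def)
  ultimately show ?thesis by blast
qed

text \<open>Evaluating the form of M w against w in two ways gives c = \<open>cnj c\<close>. Since
  \<open>matrix_eigenvalues\<close> asks for a real vector, the real or the imaginary part of
  \<open>w\<close> serves, whichever is nonzero.\<close>

lemma symmetric_complex_eigenvalue:
  assumes "finite V" and sym: "\<And>u v. u \<in> V \<Longrightarrow> v \<in> V \<Longrightarrow> M u v = M v u"
    and nz: "\<exists>u\<in>V. w u \<noteq> 0" and eig: "\<And>u. u \<in> V \<Longrightarrow> mat_op V M w u = c * w u"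
  shows "\<exists>\<mu>\<in>matrix_eigenvalues V M. c = of_real \<mu>"
proof -
  let ?s = "\<Sum>u\<in>V. w u * cnj (w u)"
  have "c * ?s = (\<Sum>u\<in>V. mat_op V M w u * cnj (w u))"
    using eig by (simp add: sum_distrib_left algebra_simps)
  also have "\<dots> = (\<Sum>u\<in>V. w u * cnj (mat_op V M w u))"
    by (rule mat_op_selfadjoint[OF sym])
  also have "\<dots> = cnj c * ?s"
    using eig by (simp add: sum_distrib_left algebra_simps)
  finally have "c * ?s = cnj c * ?s" .
  moreover have "?s \<noteq> 0"
    using sum_mult_cnj_eq_zero[OF assms(1), of w] nz by blast
  ultimately have "c = cnj c"
    by (simp only: mult_cancel_right) simp
  then have c: "c = of_real (Re c)"
    by (simp add: complex_eq_iff)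
  have "(\<Sum>v\<in>V. M u v * Re (w v)) = Re c * Re (w u) \<and>
        (\<Sum>v\<in>V. M u v * Im (w v)) = Re c * Im (w u)" if "u \<in> V" for u
  proof -
    have "(\<Sum>v\<in>V. of_real (M u v) * w v) = of_real (Re c) * w u"
      using eig[OF that] c by (simp add: mat_op_def)
    then show ?thesis
      by (simp add: complex_eq_iff)
  qed
  moreover have "(\<exists>u\<in>V. Re (w u) \<noteq> 0) \<or> (\<exists>u\<in>V. Im (w u) \<noteq> 0)"
    using nz by (auto simp: complex_eq_iff)
  ultimately have "Re c \<in> matrix_eigenvalues V M"
    unfolding matrix_eigenvalues_def mem_Collect_eq
    by (elim disjE) (rule exI[of _ "\<lambda>u. Re (w u)"] exI[of _ "\<lambda>u. Im (w u)"], simp)+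
  then show ?thesis using c by blast
qed

text \<open>
  Otherwise the orbit of a vector in the image of \<open>q(M)\<close> contains an eigenvector \<open>w = q(M) x\<close>; then
  \<open>q(M) (q(M) x) = 0\<close> and self-adjointness give \<open>w = 0\<close>.
\<close>

lemma symmetric_poly_annihilates:
  assumes "finite V" and sym: "\<And>u v. u \<in> V \<Longrightarrow> v \<in> V \<Longrightarrow> M u v = M v u"
    and roots: "\<And>\<mu>. \<mu> \<in> matrix_eigenvalues V M \<Longrightarrow> poly q \<mu> = 0" and "u \<in> V"
  shows "poly_op V M (map_poly of_real q) y u = 0"
proof (rule ccontr)
  let ?q = "map_poly of_real q :: complex poly"
  assume "poly_op V M ?q y u \<noteq> 0"
  then obtain g c where gc: "\<exists>u\<in>V. poly_op V M g (poly_op V M ?q y) u \<noteq> 0"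
    "\<And>u. u \<in> V \<Longrightarrow> mat_op V M (poly_op V M g (poly_op V M ?q y)) u
                = c * poly_op V M g (poly_op V M ?q y) u"
    using poly_op_orbit_eigenvector[OF assms(1), of "poly_op V M ?q y"] \<open>u \<in> V\<close> by blast
  define x where "x = poly_op V M g y"
  define w where "w = poly_op V M ?q x"
  have w: "w = poly_op V M g (poly_op V M ?q y)"
    by (simp add: w_def x_def mult.commute flip: poly_op_mult)
  have "\<exists>\<mu>\<in>matrix_eigenvalues V M. c = of_real \<mu>"
    using gc w sym by (intro symmetric_complex_eigenvalue[OF assms(1), of M w]) auto
  then obtain \<mu> where "\<mu> \<in> matrix_eigenvalues V M" "c = of_real \<mu>" by blast
  moreover have "poly ?q (of_real \<mu>) = of_real (poly q \<mu>)"
    by (induction q) (simp_all add: map_poly_pCons)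
  ultimately have "poly ?q c = 0"
    using roots by simp
  then have "poly_op V M ?q w v = 0" if "v \<in> V" for v
    using poly_op_eigenvector[of V M w c v ?q] gc(2) w that by simp
  then have "(\<Sum>v\<in>V. w v * cnj (w v)) = 0"
    unfolding w_def by (subst poly_op_selfadjoint[OF sym]) (simp_all add: w_def)
  then show False
    using sum_mult_cnj_eq_zero[OF assms(1), of w] gc(1) w by auto
qed

section \<open>Complete multipartite graphs as vertex partitions\<close>

text \<open>Replaces isomorphisms by a labelling \<open>p\<close> of the vertices by parts, so that
  all later arguments stay inside \<open>V\<close>.\<close>

lemma graph_iso_kmp_iff:
  assumes "finite V"
  shows "graph_iso V E (kmp_vertices r ns) (kmp_edges r ns) \<longleftrightarrow>
    (\<exists>p. (\<forall>u\<in>V. p u < r) \<and> (\<forall>i<r. card {u \<in> V. p u = i} = ns i) \<and>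
         (\<forall>u\<in>V. \<forall>v\<in>V. E u v \<longleftrightarrow> p u \<noteq> p v))"
    (is "?L \<longleftrightarrow> ?R")
proof
  assume ?L
  then obtain f where f: "bij_betw f V (kmp_vertices r ns)"
    "\<forall>u\<in>V. \<forall>v\<in>V. E u v \<longleftrightarrow> kmp_edges r ns (f u) (f v)"
    by (auto simp: graph_iso_def)
  have mem: "f u \<in> kmp_vertices r ns" if "u \<in> V" for u
    using f(1) that bij_betwE by blast
  have "card {u \<in> V. fst (f u) = i} = ns i" if "i < r" for i
  proof -
    have "bij_betw f {u \<in> V. fst (f u) = i} (Pair i ` {..<ns i})"
    proof (rule bij_betw_subset[OF f(1)])
      show "f ` {u \<in> V. fst (f u) = i} = Pair i ` {..<ns i}"
      proof
        show "f ` {u \<in> V. fst (f u) = i} \<subseteq> Pair i ` {..<ns i}"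
          using mem by (force simp: kmp_vertices_def)
        show "Pair i ` {..<ns i} \<subseteq> f ` {u \<in> V. fst (f u) = i}"
        proof
          fix x assume x: "x \<in> Pair i ` {..<ns i}"
          then have "x \<in> f ` V"
            using that f(1) by (auto simp: kmp_vertices_def bij_betw_def)
          then show "x \<in> f ` {u \<in> V. fst (f u) = i}"
            using x by auto
        qed
      qed
    qed auto
    then show ?thesis
      by (simp add: bij_betw_same_card card_image inj_on_def)
  qed
  then show ?R
    using f(2) mem
    by (intro exI[of _ "\<lambda>u. fst (f u)"])
       (auto simp: kmp_edges_def kmp_vertices_def case_prod_unfold)
next
  assume ?R
  then obtain p where p: "\<forall>u\<in>V. p u < r" "\<forall>i<r. card {u \<in> V. p u = i} = ns i"
    "\<forall>u\<in>V. \<forall>v\<in>V. E u v \<longleftrightarrow> p u \<noteq> p v" by blast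
  \<comment> \<open>Each class is numbered by a bijection; a vertex is then sent to the pair of its
    part and its number.\<close>
  have "\<exists>g. bij_betw g {u \<in> V. p u = i} {..<ns i}" if "i < r" for i
    using that p(2) assms by (intro finite_same_card_bij) auto
  then obtain g where g: "\<And>i. i < r \<Longrightarrow> bij_betw (g i) {u \<in> V. p u = i} {..<ns i}"
    by metis
  define f where "f u = (p u, g (p u) u)" for u
  have "bij_betw f V (kmp_vertices r ns)"
    unfolding bij_betw_def
  proof
    show "inj_on f V"
    proof (rule inj_onI)
      fix u v assume "u \<in> V" "v \<in> V" "f u = f v"
      then show "u = v"
        using g[of "p u"] p(1) by (auto simp: f_def bij_betw_def inj_on_def)
    qed
    show "f ` V = kmp_vertices r ns"
    proof
      show "f ` V \<subseteq> kmp_vertices r ns"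
        using p(1) g by (fastforce simp: f_def kmp_vertices_def bij_betw_def)
      show "kmp_vertices r ns \<subseteq> f ` V"
      proof
        fix x assume "x \<in> kmp_vertices r ns"
        then obtain i j where ij: "x = (i, j)" "i < r" "j < ns i"
          by (auto simp: kmp_vertices_def)
        then have "j \<in> g i ` {u \<in> V. p u = i}"
          using g[of i] by (simp add: bij_betw_def)
        then show "x \<in> f ` V"
          using ij by (auto simp: f_def)
      qed
    qed
  qed
  moreover from this have "f u \<in> kmp_vertices r ns" if "u \<in> V" for u
    using that bij_betwE by blast
  ultimately show ?L
    unfolding graph_iso_def using p(3)
    by (intro exI[of _ f]) (auto simp: kmp_edges_def f_def)
qed

section \<open>The normalized Laplacian of a connected graph\<close>

text \<open>With two vertices, connectedness excludes isolated vertices, so every division by a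
  degree is genuine.\<close>

locale nontrivial_connected_graph =
  fixes V :: "'a set" and E :: "'a \<Rightarrow> 'a \<Rightarrow> bool"
  assumes simple: "simple_graph V E" and connected: "connected_graph V E"
    and two_vertices: "card V \<ge> 2"
begin

definition nbrs :: "'a \<Rightarrow> 'a set" where
  "nbrs u = {v \<in> V. E u v}"

abbreviation deg :: "'a \<Rightarrow> real" where
  "deg u \<equiv> real (Defs.degree V E u)"

lemma finite_V [simp]: "finite V"
  using simple by (simp add: simple_graph_def)

lemma edge_sym: "E u v \<longleftrightarrow> E v u"
  using simple by (auto simp: simple_graph_def)

lemma edge_irrefl [simp]: "\<not> E u u"
  using simple by (auto simp: simple_graph_def)

lemma finite_nbrs [simp]: "finite (nbrs u)"
  by (simp add: nbrs_def)

lemma nbrs_subset: "nbrs u \<subseteq> V"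
  by (auto simp: nbrs_def)

lemma card_nbrs: "card (nbrs u) = Defs.degree V E u"
  by (simp add: nbrs_def Defs.degree_def)

lemma nbrs_nonempty:
  assumes "u \<in> V"
  shows "nbrs u \<noteq> {}"
proof -
  have "\<not> V \<subseteq> {u}"
    using two_vertices card_mono[of "{u}" V] by auto
  then obtain v where "v \<in> V" "v \<noteq> u" by auto
  then have "E\<^sup>*\<^sup>* u v"
    using assms connected by (simp add: connected_graph_def)
  then obtain w where "E u w"
    using \<open>v \<noteq> u\<close> by (metis converse_rtranclpE)
  then show ?thesis
    using simple by (auto simp: nbrs_def simple_graph_def)
qed

lemma deg_pos: "u \<in> V \<Longrightarrow> deg u > 0"
  using nbrs_nonempty[of u] card_nbrs[of u] by (metis card_gt_0_iff finite_nbrs of_nat_0_less_iff)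

lemma norm_laplacian_sym: "norm_laplacian V E u v = norm_laplacian V E v u"
  using edge_sym[of u v] by (simp add: norm_laplacian_def mult.commute)

section \<open>The eigenvalue equation without square roots\<close>

lemma norm_laplacian_apply:
  assumes "u \<in> V"
  shows "(\<Sum>v\<in>V. norm_laplacian V E u v * x v) = x u - (\<Sum>w\<in>nbrs u. x w / sqrt (deg u * deg w))"
proof -
  have "(\<Sum>v\<in>V. norm_laplacian V E u v * x v)
      = (\<Sum>v\<in>V. (if v = u then x v else 0) - (if E u v then x v / sqrt (deg u * deg v) else 0))"
    by (intro sum.cong) (auto simp: norm_laplacian_def)
  also have "\<dots> = x u - (\<Sum>v\<in>V. if E u v then x v / sqrt (deg u * deg v) else 0)"
    using assms by (simp add: sum_subtractf)
  finally show ?thesis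
    by (simp add: nbrs_def flip: sum.inter_filter)
qed

text \<open>The substitution x = D^(1/2) y cancels the square roots inside the sum and leaves the
  combinatorial Laplacian (D - A) y.\<close>

lemma norm_laplacian_apply_scaled:
  assumes "u \<in> V"
  shows "(\<Sum>v\<in>V. norm_laplacian V E u v * (sqrt (deg v) * y v))
       = (deg u * y u - (\<Sum>w\<in>nbrs u. y w)) / sqrt (deg u)"
proof -
  have "(\<Sum>w\<in>nbrs u. sqrt (deg w) * y w / sqrt (deg u * deg w)) = (\<Sum>w\<in>nbrs u. y w / sqrt (deg u))"
  proof (rule sum.cong)
    fix w assume "w \<in> nbrs u"
    then have "deg w > 0" using nbrs_subset deg_pos by blast
    then show "sqrt (deg w) * y w / sqrt (deg u * deg w) = y w / sqrt (deg u)"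
      by (simp add: real_sqrt_mult)
  qed simp
  moreover have "sqrt (deg u) * y u = deg u * y u / sqrt (deg u)"
    using deg_pos[OF assms] by (simp add: field_simps)
  ultimately show ?thesis
    using assms by (simp add: norm_laplacian_apply diff_divide_distrib sum_divide_distrib)
qed

text \<open>With y = D^(-1/2) x the equation L x = \<mu> x becomes A y = (1 - \<mu>) D y, the form
  in which the multipartite spectra are computed.\<close>

lemma norm_lap_eigenvalue_iff:
  "\<mu> \<in> norm_lap_eigenvalues V E \<longleftrightarrow>
     (\<exists>y. (\<exists>u\<in>V. y u \<noteq> 0) \<and> (\<forall>u\<in>V. (\<Sum>w\<in>nbrs u. y w) = (1 - \<mu>) * deg u * y u))"
proof
  assume "\<mu> \<in> norm_lap_eigenvalues V E"
  then obtain x where x: "\<exists>u\<in>V. x u \<noteq> 0"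
    "\<And>u. u \<in> V \<Longrightarrow> (\<Sum>v\<in>V. norm_laplacian V E u v * x v) = \<mu> * x u"
    by (auto simp: norm_lap_eigenvalues_def matrix_eigenvalues_def)
  define y where "y u = x u / sqrt (deg u)" for u
  have xy: "x u = sqrt (deg u) * y u" if "u \<in> V" for u
    using deg_pos[OF that] by (simp add: y_def)
  have "(\<Sum>w\<in>nbrs u. y w) = (1 - \<mu>) * deg u * y u" if u: "u \<in> V" for u
  proof -
    have "(\<Sum>v\<in>V. norm_laplacian V E u v * x v)
        = (\<Sum>v\<in>V. norm_laplacian V E u v * (sqrt (deg v) * y v))"
      by (intro sum.cong) (simp_all add: xy)
    then have "(deg u * y u - (\<Sum>w\<in>nbrs u. y w)) / sqrt (deg u) = \<mu> * (sqrt (deg u) * y u)"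
      using x(2)[OF u] norm_laplacian_apply_scaled[OF u] xy[OF u] by simp
    then show ?thesis
      using deg_pos[OF u] by (simp add: field_simps)
  qed
  moreover have "\<exists>u\<in>V. y u \<noteq> 0"
    using x(1) xy by auto
  ultimately show "\<exists>y. (\<exists>u\<in>V. y u \<noteq> 0) \<and> (\<forall>u\<in>V. (\<Sum>w\<in>nbrs u. y w) = (1 - \<mu>) * deg u * y u)"
    by blast
next
  assume "\<exists>y. (\<exists>u\<in>V. y u \<noteq> 0) \<and> (\<forall>u\<in>V. (\<Sum>w\<in>nbrs u. y w) = (1 - \<mu>) * deg u * y u)"
  then obtain y where y: "\<exists>u\<in>V. y u \<noteq> 0"
    "\<And>u. u \<in> V \<Longrightarrow> (\<Sum>w\<in>nbrs u. y w) = (1 - \<mu>) * deg u * y u" by blast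
  have "(\<Sum>v\<in>V. norm_laplacian V E u v * (sqrt (deg v) * y v)) = \<mu> * (sqrt (deg u) * y u)"
    if u: "u \<in> V" for u
    using deg_pos[OF u] unfolding norm_laplacian_apply_scaled[OF u] y(2)[OF u]
    by (simp add: field_simps)
  moreover have "\<exists>u\<in>V. sqrt (deg u) * y u \<noteq> 0"
    using y(1) deg_pos by fastforce
  ultimately show "\<mu> \<in> norm_lap_eigenvalues V E"
    by (auto simp: norm_lap_eigenvalues_def matrix_eigenvalues_def
        intro!: exI[of _ "\<lambda>u. sqrt (deg u) * y u"])
qed

lemma zero_eigenvalue: "0 \<in> norm_lap_eigenvalues V E"
  unfolding norm_lap_eigenvalue_iff
  using connected by (intro exI[of _ "\<lambda>_. 1"]) (auto simp: card_nbrs connected_graph_def)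

text \<open>The maximum of \<open>y\<close> propagates along edges.\<close>

lemma harmonic_imp_constant:
  fixes y :: "'a \<Rightarrow> real"
  assumes harm: "\<And>u. u \<in> V \<Longrightarrow> (\<Sum>w\<in>nbrs u. y w) = deg u * y u"
  shows "\<exists>k. \<forall>u\<in>V. y u = k"
proof -
  have "V \<noteq> {}" using connected by (simp add: connected_graph_def)
  then have "Max (y ` V) \<in> y ` V" by (intro Max_in) auto
  then obtain m where m: "m \<in> V" "y m = Max (y ` V)" by auto
  have le: "y u \<le> y m" if "u \<in> V" for u
    using that m by simp
  have max_nbr: "y v = y m" if "u \<in> V" "y u = y m" "E u v" for u v
  proof -
    have "(\<Sum>w\<in>nbrs u. y m - y w) = 0"
      using harm[OF that(1)] that(2) by (simp add: sum_subtractf card_nbrs)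
    moreover have "v \<in> nbrs u"
      using that simple by (auto simp: nbrs_def simple_graph_def)
    ultimately have "y m - y v = 0"
      using le nbrs_subset[of u] by (subst (asm) sum_nonneg_eq_0_iff) auto
    then show ?thesis by simp
  qed
  have "y u = y m" if "u \<in> V" for u
  proof -
    have "E\<^sup>*\<^sup>* m u"
      using that m(1) connected by (simp add: connected_graph_def)
    then have "u \<in> V \<and> y u = y m"
    proof (induction rule: rtranclp_induct)
      case (step v w)
      then have "w \<in> V"
        using simple by (auto simp: simple_graph_def)
      then show ?case
        using max_nbr[of v w] step by blast
    qed (simp add: m)
    then show ?thesis by simp
  qed
  then show ?thesis by blast
qed

text \<open>With B = I - L one has L^2 = 2 L - I + B^2, and the entries of B^2 are weighted sums
  over common neighbours.\<close>

lemma norm_laplacian_square: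
  assumes "u \<in> V" "v \<in> V"
  shows "(\<Sum>w\<in>V. norm_laplacian V E u w * norm_laplacian V E w v)
       = 2 * norm_laplacian V E u v - (if u = v then 1 else 0)
         + (\<Sum>w\<in>nbrs u \<inter> nbrs v. 1 / deg w) / sqrt (deg u * deg v)"
proof -
  let ?L = "norm_laplacian V E"
  let ?a = "\<lambda>u v. if E u v then 1 / sqrt (deg u * deg v) else 0"
  have "(\<Sum>w\<in>nbrs u. ?L w v / sqrt (deg u * deg w))
      = (\<Sum>w\<in>nbrs u. (if w = v then ?a u v else 0) - ?a w v / sqrt (deg u * deg w))"
    by (intro sum.cong) (auto simp: norm_laplacian_def nbrs_def diff_divide_distrib)
  also have "\<dots> = ?a u v - (\<Sum>w\<in>nbrs u. ?a w v / sqrt (deg u * deg w))"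
    using assms by (auto simp: sum_subtractf nbrs_def)
  also have "(\<Sum>w\<in>nbrs u. ?a w v / sqrt (deg u * deg w))
      = (\<Sum>w\<in>nbrs u. if w \<in> nbrs v then 1 / deg w / sqrt (deg u * deg v) else 0)"
    by (intro sum.cong) (auto simp: nbrs_def edge_sym[of v] real_sqrt_mult)
  also have "\<dots> = (\<Sum>w\<in>nbrs u \<inter> nbrs v. 1 / deg w / sqrt (deg u * deg v))"
    by (simp only: sum.inter_restrict finite_nbrs)
  also have "\<dots> = (\<Sum>w\<in>nbrs u \<inter> nbrs v. 1 / deg w) / sqrt (deg u * deg v)"
    by (simp add: sum_divide_distrib)
  finally show ?thesis
    using assms by (simp add: norm_laplacian_apply[where x = "\<lambda>w. ?L w v"])
      (simp add: norm_laplacian_def)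
qed

text \<open>Every column of (L - 1) (L - \<theta>) lies in the one-dimensional kernel of L; symmetry
  then fixes the matrix up to one scalar \<open>c\<close>.\<close>

lemma three_eigenvalues_imp_common_nbrs:
  assumes eig: "norm_lap_eigenvalues V E = {0, 1, \<theta>}"
  obtains c where "c > 0"
    "\<And>u v. u \<in> V \<Longrightarrow> v \<in> V \<Longrightarrow> (\<Sum>w\<in>nbrs u \<inter> nbrs v. 1 / deg w)
       = (if E u v then 1 - \<theta> else 0) + c * deg u * deg v"
proof -
  let ?L = "norm_laplacian V E"
  \<comment> \<open>\<open>N\<close> is the matrix (L - 1) (L - \<theta>), and \<open>P\<close> is
    \<open>N\<close> with the factor 1 / sqrt (d u * d v) cleared.\<close>
  define P where
    "P u v = (\<Sum>w\<in>nbrs u \<inter> nbrs v. 1 / deg w) - (if E u v then 1 - \<theta> else 0)" for u v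
  define N where
    "N u v = (\<Sum>w\<in>V. ?L u w * ?L w v) - (1 + \<theta>) * ?L u v + (if u = v then \<theta> else 0)" for u v
  have NP: "N u v = P u v / sqrt (deg u * deg v)" if "u \<in> V" "v \<in> V" for u v
    using that by (simp add: N_def P_def norm_laplacian_square)
      (simp add: norm_laplacian_def algebra_simps add_divide_distrib diff_divide_distrib)
  have LN: "(\<Sum>w\<in>V. ?L u w * N w v) = 0" if u: "u \<in> V" and v: "v \<in> V" for u v
  proof -
    let ?\<delta> = "\<lambda>u. if u = v then 1 else 0 :: complex"
    \<comment> \<open>X (X - 1) (X - \<theta>) = X^3 + t X^2 + \<theta> X. Applied to the unit
      vector at \<open>v\<close>, the quotient by X yields column \<open>v\<close> of
      \<open>N\<close>.\<close>
    define t where "t = - (1 + \<theta>)"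
    have "poly [:0, \<theta>, t, 1:] \<mu> = 0" if "\<mu> \<in> matrix_eigenvalues V ?L" for \<mu>
      using that eig unfolding norm_lap_eigenvalues_def t_def by (auto simp: algebra_simps)
    then have "poly_op V ?L (map_poly of_real [:0, \<theta>, t, 1:]) ?\<delta> u = 0"
      by (rule symmetric_poly_annihilates[OF finite_V norm_laplacian_sym _ u])
    moreover have "poly_op V ?L (map_poly of_real [:\<theta>, t, 1:]) ?\<delta> = (\<lambda>w. of_real (N w v))"
    proof -
      have "mat_op V ?L ?\<delta> = (\<lambda>w. of_real (?L w v))"
        using v by (simp add: mat_op_def fun_eq_iff if_distrib cong: if_cong)
      moreover have "mat_op V ?L (\<lambda>w. of_real (?L w v)) = (\<lambda>w. of_real (\<Sum>x\<in>V. ?L w x * ?L x v))"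
        by (simp add: mat_op_def fun_eq_iff)
      ultimately have "poly_op V ?L (map_poly of_real [:\<theta>, t, 1:]) ?\<delta> =
          (\<lambda>w. of_real \<theta> * ?\<delta> w + (of_real t * of_real (?L w v) + of_real (\<Sum>x\<in>V. ?L w x * ?L x v)))"
        by (simp add: map_poly_pCons mat_op_add mat_op_scale)
      then show ?thesis
        by (simp add: N_def t_def fun_eq_iff algebra_simps)
    qed
    ultimately have "mat_op V ?L (\<lambda>w. of_real (N w v)) u = 0"
      by (simp add: map_poly_pCons)
    then show ?thesis
      by (simp add: mat_op_def flip: of_real_mult of_real_sum)
  qed
  have "\<exists>k. \<forall>u\<in>V. P u v = k * deg u" if v: "v \<in> V" for v
  proof -
    \<comment> \<open>Column \<open>v\<close> of \<open>N\<close> lies in the kernel of L, so after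
      this rescaling it is harmonic and therefore constant.\<close>
    define y where "y u = N u v / sqrt (deg u)" for u
    have Ny: "N u v = sqrt (deg u) * y u" if "u \<in> V" for u
      using deg_pos[OF that] by (simp add: y_def)
    have "(\<Sum>w\<in>nbrs u. y w) = deg u * y u" if u: "u \<in> V" for u
    proof -
      have "(\<Sum>w\<in>V. ?L u w * (sqrt (deg w) * y w)) = (\<Sum>w\<in>V. ?L u w * N w v)"
        by (intro sum.cong) (simp_all add: Ny)
      then show ?thesis
        using LN[OF u v] deg_pos[OF u] by (simp add: norm_laplacian_apply_scaled[OF u])
    qed
    then obtain k where k: "\<forall>u\<in>V. y u = k"
      using harmonic_imp_constant by blast
    have "P u v = k * sqrt (deg v) * deg u" if u: "u \<in> V" for u
    proof -
      have "P u v = sqrt (deg u) * k * sqrt (deg u * deg v)"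
        using NP[OF u v] Ny[OF u] k u deg_pos[OF u] deg_pos[OF v] by (simp add: field_simps)
      also have "\<dots> = k * sqrt (deg v) * (sqrt (deg u) * sqrt (deg u))"
        by (simp only: real_sqrt_mult mult_ac)
      finally show ?thesis by simp
    qed
    then show ?thesis by blast
  qed
  then obtain k where k: "\<And>u v. u \<in> V \<Longrightarrow> v \<in> V \<Longrightarrow> P u v = k v * deg u"
    by metis
  have Psym: "P u v = P v u" for u v
    by (simp add: P_def edge_sym Int_commute)
  obtain a where a: "a \<in> V"
    using connected by (auto simp: connected_graph_def)
  \<comment> \<open>Symmetry gives k v * d a = k a * d v, so \<open>k\<close> is proportional to the
    degree; the fixed vertex \<open>a\<close> determines the factor.\<close>
  define c where "c = k a / deg a"
  have "k v = c * deg v" if v: "v \<in> V" for v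
    using k[OF a v] k[OF v a] Psym[of a v] deg_pos[OF a] by (simp add: c_def field_simps)
  then have P: "P u v = c * deg u * deg v" if "u \<in> V" "v \<in> V" for u v
    using k that by simp
  have "P a a > 0"
    unfolding P_def using nbrs_nonempty[OF a] nbrs_subset deg_pos by (auto intro!: sum_pos simp: subset_iff)
  then have "c > 0"
    using P[OF a a] by (simp add: zero_less_mult_iff)
  moreover have "(\<Sum>w\<in>nbrs u \<inter> nbrs v. 1 / deg w) = (if E u v then 1 - \<theta> else 0) + c * deg u * deg v"
    if "u \<in> V" "v \<in> V" for u v
    using P[OF that] by (simp add: P_def)
  ultimately show thesis by (rule that)
qed

subsection \<open>From three eigenvalues to multipartite graphs\<close>

text \<open>All weights 1 / d w are positive. Passing from the neighbours of one vertex to the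
  common ones can only lower the sum, which compares the degrees both ways; once they agree the sums
  are equal and no neighbour can be missing.\<close>

lemma nonadjacent_imp_twins:
  assumes "c > 0"
    and common: "\<And>u v. u \<in> V \<Longrightarrow> v \<in> V \<Longrightarrow> (\<Sum>w\<in>nbrs u \<inter> nbrs v. 1 / deg w)
       = (if E u v then l else 0) + c * deg u * deg v"
    and "u \<in> V" "v \<in> V" "\<not> E u v"
  shows "nbrs u = nbrs v"
proof -
  have pos: "1 / deg w > 0" if "w \<in> nbrs x" for w x
    using that nbrs_subset deg_pos by auto
  have deg_le: "deg b \<le> deg a" if "a \<in> V" "b \<in> V" "\<not> E a b" for a b
  proof -
    have "(\<Sum>w\<in>nbrs a \<inter> nbrs b. 1 / deg w) \<le> (\<Sum>w\<in>nbrs a \<inter> nbrs a. 1 / deg w)"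
      using pos by (intro sum_mono2) auto
    then have "(c * deg a) * deg b \<le> (c * deg a) * deg a"
      using common[of a b] common[of a a] that by simp
    then show ?thesis
      using deg_pos[OF that(1)] \<open>c > 0\<close> by simp
  qed
  have subset: "nbrs a \<subseteq> nbrs b" if ab: "a \<in> V" "b \<in> V" "\<not> E a b" for a b
  proof (rule ccontr)
    assume "\<not> nbrs a \<subseteq> nbrs b"
    then obtain x where x: "x \<in> nbrs a - nbrs a \<inter> nbrs b" by auto
    have "deg a = deg b"
      using deg_le[of a b] deg_le[of b a] ab edge_sym[of a b] by simp
    then have "(\<Sum>w\<in>nbrs a \<inter> nbrs b. 1 / deg w) = (\<Sum>w\<in>nbrs a. 1 / deg w)"
      using common[of a b] common[of a a] ab by simp
    moreover have "(\<Sum>w\<in>nbrs a \<inter> nbrs b. 1 / deg w) < (\<Sum>w\<in>nbrs a. 1 / deg w)"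
      using x pos[of x a] by (intro sum_strict_mono2[of _ _ x]) auto
    ultimately show False by simp
  qed
  show ?thesis
    using subset[of u v] subset[of v u] assms edge_sym[of u v] by auto
qed

text \<open>The neighbourhoods of adjacent vertices cover \<open>V\<close>, so inclusion-exclusion
  evaluates the sum of 1 / d x over all of \<open>V\<close> from any edge. The edges
  \<open>u v\<close> and \<open>w v\<close> share \<open>v\<close>, and comparing them relates d u
  to d w.\<close>

lemma triangle_imp_equal_degree:
  assumes "c > 0"
    and common: "\<And>u v. u \<in> V \<Longrightarrow> v \<in> V \<Longrightarrow> (\<Sum>w\<in>nbrs u \<inter> nbrs v. 1 / deg w)
       = (if E u v then l else 0) + c * deg u * deg v"
    and cover: "\<And>a b. a \<in> V \<Longrightarrow> b \<in> V \<Longrightarrow> E a b \<Longrightarrow> nbrs a \<union> nbrs b = V"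
    and V: "u \<in> V" "v \<in> V" "w \<in> V" and edges: "E u v" "E w v" "E u w"
  shows "deg u = deg w"
proof -
  have sum_V: "(\<Sum>x\<in>V. 1 / deg x) = c * (deg a * deg a + deg b * deg b - deg a * deg b) - l"
    if "a \<in> V" "b \<in> V" "E a b" for a b
    using sum.union_inter[of "nbrs a" "nbrs b" "\<lambda>x. 1 / deg x"] that
      common[of a b] common[of a a] common[of b b] cover[of a b]
    by (simp add: algebra_simps)
  have "c * (deg u * deg u + deg v * deg v - deg u * deg v)
      = c * (deg w * deg w + deg v * deg v - deg w * deg v)"
    using sum_V[of u v] sum_V[of w v] V edges by linarith
  then have "deg u * deg u + deg v * deg v - deg u * deg v
      = deg w * deg w + deg v * deg v - deg w * deg v"
    using \<open>c > 0\<close> by simp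
  then have "(deg u - deg w) * (deg u + deg w - deg v) = 0"
    by (simp add: algebra_simps)
  \<comment> \<open>The second factor is positive: the neighbourhoods of \<open>u\<close> and
    \<open>w\<close> cover \<open>V\<close>, while \<open>v\<close> misses itself.\<close>
  moreover have "deg u + deg w > deg v"
  proof -
    have "card V \<le> Defs.degree V E u + Defs.degree V E w"
      using card_Un_le[of "nbrs u" "nbrs w"] cover[of u w] V edges by (simp add: card_nbrs)
    moreover have "Defs.degree V E v < card V"
    proof -
      have "nbrs v \<subset> V"
        using V edge_irrefl[of v] unfolding nbrs_def by blast
      then show ?thesis
        using psubset_card_mono[of V "nbrs v"] by (simp add: card_nbrs)
    qed
    ultimately show ?thesis by linarith
  qed
  ultimately show ?thesis by simp
qed

text \<open>A neighbourhood serves as the name of a part; \<open>h\<close> merely numbers these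
  names.\<close>

lemma twins_imp_partition:
  assumes "\<And>u v. u \<in> V \<Longrightarrow> v \<in> V \<Longrightarrow> \<not> E u v \<Longrightarrow> nbrs u = nbrs v"
  obtains p and r :: nat where "p ` V = {..<r}" "\<And>u v. u \<in> V \<Longrightarrow> v \<in> V \<Longrightarrow> E u v \<longleftrightarrow> p u \<noteq> p v"
proof -
  obtain h where h: "bij_betw h (nbrs ` V) {..<card (nbrs ` V)}"
    using ex_bij_betw_finite_nat[of "nbrs ` V"] by (auto simp: atLeast0LessThan)
  show thesis
  proof (rule that)
    show "(h \<circ> nbrs) ` V = {..<card (nbrs ` V)}"
      using h by (simp add: bij_betw_def image_comp)
    fix u v assume "u \<in> V" "v \<in> V"
    have "E u v \<longleftrightarrow> nbrs u \<noteq> nbrs v"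
    proof
      assume "E u v"
      then have "v \<in> nbrs u" "v \<notin> nbrs v"
        using \<open>v \<in> V\<close> by (simp_all add: nbrs_def)
      then show "nbrs u \<noteq> nbrs v" by blast
    qed (use assms \<open>u \<in> V\<close> \<open>v \<in> V\<close> in blast)
    then show "E u v \<longleftrightarrow> (h \<circ> nbrs) u \<noteq> (h \<circ> nbrs) v"
      using h \<open>u \<in> V\<close> \<open>v \<in> V\<close> by (auto simp: bij_betw_def inj_on_def)
  qed
qed

lemma card_part:
  assumes "\<And>u v. u \<in> V \<Longrightarrow> v \<in> V \<Longrightarrow> E u v \<longleftrightarrow> p u \<noteq> p v" "v \<in> V"
  shows "card {u \<in> V. p u = p v} = card V - Defs.degree V E v"
proof -
  have "{u \<in> V. p u = p v} = V - nbrs v"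
    using assms by (auto simp: nbrs_def)
  then show ?thesis
    by (simp add: card_Diff_subset nbrs_subset card_nbrs)
qed

text \<open>Excludes parts of size one in the balanced case. On a complete graph A y = 0 makes every
  entry equal to the total Y, whence n Y = Y and Y = 0.\<close>

lemma complete_imp_one_not_eigenvalue:
  assumes "\<And>u. u \<in> V \<Longrightarrow> nbrs u = V - {u}"
  shows "1 \<notin> norm_lap_eigenvalues V E"
proof
  assume "1 \<in> norm_lap_eigenvalues V E"
  then obtain y where y: "\<exists>u\<in>V. y u \<noteq> 0" "\<forall>u\<in>V. (\<Sum>w\<in>nbrs u. y w) = (1 - 1) * deg u * y u"
    unfolding norm_lap_eigenvalue_iff by blast
  define Y where "Y = (\<Sum>w\<in>V. y w)"
  have yY: "y u = Y" if "u \<in> V" for u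
    using bspec[OF y(2) that] assms[OF that] that by (simp add: Y_def sum_diff1)
  have "(\<Sum>w\<in>V. y w) = (\<Sum>w\<in>V. Y)"
    by (rule sum.cong) (simp_all add: yY)
  then have "(real (card V) - 1) * Y = 0" by (simp add: algebra_simps flip: Y_def)
  then have "Y = 0" using two_vertices by simp
  then show False using y(1) yY by auto
qed

lemma three_eigenvalues_imp_multipartite:
  assumes "card (norm_lap_eigenvalues V E) = 3" "1 \<in> norm_lap_eigenvalues V E"
  shows "(\<exists>s. 1 \<le> s \<and> s \<le> card V - 1 \<and>
              graph_iso V E (kmp_vertices 2 (\<lambda>i. if i = 0 then s else card V - s))
                            (kmp_edges 2 (\<lambda>i. if i = 0 then s else card V - s))) \<or>
          (\<exists>r k. 3 \<le> r \<and> r \<le> card V - 1 \<and> r * k = card V \<and>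
              graph_iso V E (kmp_vertices r (\<lambda>_. k)) (kmp_edges r (\<lambda>_. k)))"
proof -
  obtain \<theta> where "norm_lap_eigenvalues V E = {0, 1, \<theta>}"
  proof -
    have "card (norm_lap_eigenvalues V E - {0, 1}) = 1"
      using assms zero_eigenvalue by (subst card_Diff_subset) auto
    then obtain \<theta> where "norm_lap_eigenvalues V E - {0, 1} = {\<theta>}"
      by (auto simp: card_1_singleton_iff)
    then show thesis
      using assms zero_eigenvalue by (intro that[of \<theta>]) auto
  qed
  then obtain c where c: "c > 0" and common: "\<And>u v. u \<in> V \<Longrightarrow> v \<in> V \<Longrightarrow>
      (\<Sum>w\<in>nbrs u \<inter> nbrs v. 1 / deg w) = (if E u v then 1 - \<theta> else 0) + c * deg u * deg v"
    using three_eigenvalues_imp_common_nbrs by blast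
  note twins = nonadjacent_imp_twins[OF c common]
  obtain p and r :: nat where p: "p ` V = {..<r}"
    and pE: "\<And>u v. u \<in> V \<Longrightarrow> v \<in> V \<Longrightarrow> E u v \<longleftrightarrow> p u \<noteq> p v"
    using twins_imp_partition[OF twins] by blast
  have p_less: "p u < r" if "u \<in> V" for u
    using p that by blast
  obtain a where a: "a \<in> V"
    using connected by (auto simp: connected_graph_def)
  obtain b where b: "b \<in> V" "E a b"
    using nbrs_nonempty[OF a] by (auto simp: nbrs_def)
  have "r \<ge> 2"
    using p_less[OF a] p_less[OF b(1)] pE[OF a b(1)] b(2) by linarith
  have sizes: "(\<Sum>i<r. card {u \<in> V. p u = i}) = card V"
    using sum.group[of V "{..<r}" p "\<lambda>_. 1 :: nat"] p by simp
  have part_pos: "card {u \<in> V. p u = i} > 0" if "i < r" for i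
  proof -
    obtain u where "u \<in> V" "p u = i"
      using p \<open>i < r\<close> by (metis imageE lessThan_iff)
    then show ?thesis by (auto simp: card_gt_0_iff)
  qed
  show ?thesis
  proof (cases "r = 2")
    case True
    define s where "s = card {u \<in> V. p u = 0}"
    have s_sum: "s + card {u \<in> V. p u = 1} = card V"
      using sizes True by (simp add: s_def numeral_2_eq_2)
    have "\<forall>i<2. card {u \<in> V. p u = i} = (if i = 0 then s else card V - s)"
      using s_sum by (auto simp: s_def less_2_cases_iff)
    then have "graph_iso V E (kmp_vertices 2 (\<lambda>i. if i = 0 then s else card V - s))
                             (kmp_edges 2 (\<lambda>i. if i = 0 then s else card V - s))"
      unfolding graph_iso_kmp_iff[OF finite_V] using p_less pE True by blast
    moreover have "1 \<le> s" "s \<le> card V - 1"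
      using part_pos[of 0] part_pos[of 1] True s_sum by (simp_all add: s_def)
    ultimately show ?thesis by blast
  next
    case False
    have cover: "nbrs u \<union> nbrs v = V" if "u \<in> V" "v \<in> V" "E u v" for u v
      using that pE by (auto simp: nbrs_def)
    have reg: "Defs.degree V E u = Defs.degree V E w" if V: "u \<in> V" "w \<in> V" for u w
    proof (cases "E u w")
      case True
      \<comment> \<open>With at least three parts, one avoids both \<open>u\<close> and
        \<open>w\<close>; any vertex of it completes a triangle.\<close>
      have "card {p u, p w} < card {..<r}"
        using \<open>r \<ge> 2\<close> False card_insert_le_m1[of 2 "{p w}" "p u"] by simp
      then obtain i where i: "i < r" "i \<noteq> p u" "i \<noteq> p w"
        by (metis card_mono finite.emptyI finite_insert insertCI lessThan_iff not_less subsetI)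
      then obtain v where v: "v \<in> V" "p v = i"
        using p by (metis imageE lessThan_iff)
      have "deg u = deg w"
        using i v True V by (intro triangle_imp_equal_degree[OF c common cover, of u v w])
           (auto simp: pE)
      then show ?thesis by simp
    next
      case False
      then show ?thesis
        using twins[of u w] V by (simp flip: card_nbrs)
    qed
    define k where "k = card V - Defs.degree V E a"
    have parts: "card {u \<in> V. p u = i} = k" if "i < r" for i
    proof -
      obtain v where "v \<in> V" "p v = i"
        using p \<open>i < r\<close> by (metis imageE lessThan_iff)
      then show ?thesis
        using card_part[OF pE] reg[OF a] by (auto simp: k_def)
    qed
    have rk: "r * k = card V"
      using sizes parts by simp
    have "k > 0"
      using parts[of 0] part_pos[of 0] \<open>r \<ge> 2\<close> by simp
    have "k \<noteq> 1"
    proof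
      assume "k = 1"
      have "nbrs u = V - {u}" if u: "u \<in> V" for u
      proof -
        have "card {v \<in> V. p v = p u} = 1"
          using parts[OF p_less[OF u]] \<open>k = 1\<close> by simp
        then have "{v \<in> V. p v = p u} = {u}"
          using u by (metis (mono_tags, lifting) card_1_singletonE mem_Collect_eq singletonD)
        then show ?thesis
          using pE u by (auto simp: nbrs_def)
      qed
      then show False
        using complete_imp_one_not_eigenvalue assms(2) by blast
    qed
    \<comment> \<open>Parts have at least two vertices, which yields the bound
      \<open>r \<le> card V - 1\<close>.\<close>
    then have "r * 2 \<le> card V"
      using \<open>k > 0\<close> rk by (metis One_nat_def Suc_leI less_one linorder_neqE_nat
          mult_le_mono2 numeral_2_eq_2 not_less_eq)
    moreover have "graph_iso V E (kmp_vertices r (\<lambda>_. k)) (kmp_edges r (\<lambda>_. k))"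
      unfolding graph_iso_kmp_iff[OF finite_V] using p_less pE parts by blast
    ultimately show ?thesis
      using rk False \<open>r \<ge> 2\<close> by (intro disjI2 exI[of _ r] exI[of _ k]) auto
  qed
qed

subsection \<open>Spectra of complete multipartite graphs\<close>

text \<open>No further eigenvalue occurs because summing the equation over each part gives two
  linear equations in the part sums, and for \<nu> = 1 - \<mu> nonzero these sums determine
  \<open>y\<close>.\<close>

lemma complete_bipartite_eigenvalues:
  assumes "card V \<ge> 3" "\<And>u. u \<in> V \<Longrightarrow> p u < (2::nat)"
    and pE: "\<And>u v. u \<in> V \<Longrightarrow> v \<in> V \<Longrightarrow> E u v \<longleftrightarrow> p u \<noteq> p v"
  shows "norm_lap_eigenvalues V E = {0, 1, 2}"
proof -
  define A where "A i = {u \<in> V. p u = i}" for i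
  \<comment> \<open>On the labels 0 and 1, \<open>1 - p u\<close> is the opposite part.\<close>
  have nb: "nbrs u = A (1 - p u)" if "u \<in> V" for u
    using assms(2)[OF that] assms(2) pE[OF that] by (force simp: nbrs_def A_def less_2_cases_iff)
  have V: "V = A 0 \<union> A 1" "A 0 \<inter> A 1 = {}" and fin: "finite (A i)" for i
    using assms(2) by (fastforce simp: A_def less_2_cases_iff)+
  have deg: "deg u = real (card (A (1 - p u)))" if "u \<in> V" for u
    using nb[OF that] by (simp flip: card_nbrs)
  have pos: "card (A i) > 0" if "i < 2" for i
  proof -
    obtain a where a: "a \<in> V"
      using connected by (auto simp: connected_graph_def)
    obtain b where b: "b \<in> V" "E a b"
      using nbrs_nonempty[OF a] by (auto simp: nbrs_def)
    have "p a = i \<or> p b = i"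
      using pE[OF a b(1)] b assms(2)[OF a] assms(2)[OF b(1)] that by linarith
    then show ?thesis
      using a b fin by (auto simp: card_gt_0_iff A_def)
  qed
  have "2 \<in> norm_lap_eigenvalues V E"
  proof -
    let ?y = "\<lambda>u. if p u = 0 then 1 else - 1 :: real"
    have "(\<Sum>w\<in>nbrs u. ?y w) = (1 - 2) * deg u * ?y u" if u: "u \<in> V" for u
    proof -
      have "(\<Sum>w\<in>A (1 - p u). ?y w) = (\<Sum>w\<in>A (1 - p u). - ?y u)"
        using assms(2)[OF u] by (intro sum.cong) (auto simp: A_def less_2_cases_iff)
      then show ?thesis
        by (simp add: nb[OF u] deg[OF u])
    qed
    moreover have "V \<noteq> {}"
      using assms(1) by auto
    ultimately show ?thesis
      unfolding norm_lap_eigenvalue_iff by (intro exI[of _ ?y]) auto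
  qed
  moreover have "1 \<in> norm_lap_eigenvalues V E"
  proof -
    have "card (A 0) + card (A 1) \<ge> 3"
      using assms(1) V fin by (metis card_Un_disjoint)
    then obtain i where "i < 2" "card (A i) \<ge> 2"
      by (cases "card (A 0) \<ge> 2") (auto intro: that[of 0] that[of 1])
    then obtain a b where ab: "a \<in> A i" "b \<in> A i" "a \<noteq> b"
      by (metis One_nat_def Suc_1 Suc_le_eq card_le_Suc0_iff_eq fin linorder_not_le)
    \<comment> \<open>Two vertices of one part have the same neighbours, so the difference of their
      indicators has all neighbour sums zero.\<close>
    let ?y = "\<lambda>u. (if u = a then 1 else 0) - (if u = b then 1 else 0) :: real"
    have "(\<Sum>w\<in>nbrs u. ?y w) = 0" if u: "u \<in> V" for u
      using ab by (simp add: nb[OF u] sum_subtractf fin) (auto simp: A_def)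
    then show ?thesis
      unfolding norm_lap_eigenvalue_iff using ab
      by (intro exI[of _ ?y]) (auto simp: A_def)
  qed
  moreover have "\<mu> \<in> {0, 1, 2}" if "\<mu> \<in> norm_lap_eigenvalues V E" for \<mu>
  proof -
    obtain y where y: "\<exists>u\<in>V. y u \<noteq> 0"
      "\<And>u. u \<in> V \<Longrightarrow> (\<Sum>w\<in>nbrs u. y w) = (1 - \<mu>) * deg u * y u"
      using \<open>\<mu> \<in> _\<close> by (auto simp: norm_lap_eigenvalue_iff)
    define \<nu> where "\<nu> = 1 - \<mu>"
    define Y where "Y i = (\<Sum>w\<in>A i. y w)" for i
    define k where "k i = real (card (A i))" for i
    have kpos: "k 0 > 0" "k 1 > 0"
      using pos by (simp_all add: k_def)
    have eq: "Y (1 - i) = \<nu> * k (1 - i) * y u" if "u \<in> A i" for u i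
      using that y(2)[of u] nb[of u] deg[of u] by (auto simp: A_def Y_def k_def \<nu>_def)
    have sum_eq: "k i * Y (1 - i) = \<nu> * k (1 - i) * Y i" for i
    proof -
      have "(\<Sum>u\<in>A i. Y (1 - i)) = (\<Sum>u\<in>A i. \<nu> * k (1 - i) * y u)"
        using eq by (intro sum.cong) auto
      then show ?thesis
        by (simp add: k_def Y_def sum_distrib_left)
    qed
    have "\<nu> = 0 \<or> \<nu> = 1 \<or> \<nu> = - 1"
    proof (rule ccontr)
      assume H: "\<not> ?thesis"
      then have "\<nu>\<^sup>2 \<noteq> 1" by (simp add: power2_eq_1_iff)
      have e: "k 0 * Y 1 = \<nu> * k 1 * Y 0" "k 1 * Y 0 = \<nu> * k 0 * Y 1"
        using sum_eq[of 0] sum_eq[of 1] by simp_all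
      \<comment> \<open>Substituting one part equation into the other multiplies k 0 * Y 1 by
        \<open>\<nu>\<^sup>2\<close>.\<close>
      then have "(1 - \<nu>\<^sup>2) * (k 0 * Y 1) = 0"
        by (simp add: power2_eq_square algebra_simps)
      then have "Y 1 = 0"
        using \<open>\<nu>\<^sup>2 \<noteq> 1\<close> kpos by simp
      moreover from this have "Y 0 = 0"
        using e kpos by simp
      ultimately have "y u = 0" if "u \<in> V" for u
        using that V(1) eq[of u 0] eq[of u 1] H kpos by auto
      then show False using y(1) by blast
    qed
    then show ?thesis by (auto simp: \<nu>_def)
  qed
  ultimately show ?thesis
    using zero_eigenvalue by blast
qed

text \<open>The graph is regular of degree (r - 1) k, and a neighbour sum is the total minus one
  part sum. An eigenvector is thus controlled by its total \<open>Y\<close> and its part sums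
  \<open>Z i\<close>.\<close>

lemma balanced_multipartite_eigenvalues:
  assumes "r \<ge> 2" "k \<ge> 2" "\<And>u. u \<in> V \<Longrightarrow> p u < (r::nat)"
    and parts: "\<And>i. i < r \<Longrightarrow> card {u \<in> V. p u = i} = k"
    and pE: "\<And>u v. u \<in> V \<Longrightarrow> v \<in> V \<Longrightarrow> E u v \<longleftrightarrow> p u \<noteq> p v"
  shows "norm_lap_eigenvalues V E = {0, 1, real r / (real r - 1)}"
proof -
  define A where "A i = {u \<in> V. p u = i}" for i
  have fin: "finite (A i)" and AV: "A i \<subseteq> V" for i
    by (auto simp: A_def)
  have cardA: "card (A i) = k" if "i < r" for i
    using parts[OF that] by (simp add: A_def)
  have sum_parts: "(\<Sum>i<r. \<Sum>u\<in>A i. f u) = (\<Sum>u\<in>V. f u)" for f :: "'a \<Rightarrow> real"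
    unfolding A_def using assms(3) by (intro sum.group) auto
  have sum_nb: "(\<Sum>w\<in>nbrs u. f w) = (\<Sum>w\<in>V. f w) - (\<Sum>w\<in>A (p u). f w)"
    if "u \<in> V" for u and f :: "'a \<Rightarrow> real"
  proof -
    have "nbrs u = V - A (p u)"
      using that pE by (auto simp: nbrs_def A_def)
    then show ?thesis
      using AV by (simp add: sum_diff)
  qed
  have deg: "deg u = (real r - 1) * real k" if "u \<in> V" for u
    using sum_nb[OF that, of "\<lambda>_. 1"] sum_parts[of "\<lambda>_. 1"] assms(3)[OF that]
    by (simp add: card_nbrs cardA algebra_simps)
  have "real r / (real r - 1) \<in> norm_lap_eigenvalues V E"
  proof -
    \<comment> \<open>A vector constant on parts with total zero: its neighbour sums are -k g, so 1
      - \<mu> = -1 / (r - 1).\<close>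
    define g where "g i = (if i = 0 then 1 else 0) - (if i = 1 then 1 else 0 :: real)" for i :: nat
    have sA: "(\<Sum>u\<in>A i. g (p u)) = k * g i" if "i < r" for i
    proof -
      have "(\<Sum>u\<in>A i. g (p u)) = (\<Sum>u\<in>A i. g i)"
        by (intro sum.cong) (auto simp: A_def)
      then show ?thesis using cardA[OF that] by simp
    qed
    have sV: "(\<Sum>u\<in>V. g (p u)) = 0"
    proof -
      have "(\<Sum>u\<in>V. g (p u)) = (\<Sum>i<r. k * g i)"
        unfolding sum_parts[symmetric] by (intro sum.cong) (auto simp: sA)
      also have "\<dots> = 0"
        using \<open>r \<ge> 2\<close> by (simp add: g_def sum_subtractf flip: sum_distrib_left)
      finally show ?thesis .
    qed
    have "(\<Sum>w\<in>nbrs u. g (p w)) = (1 - real r / (real r - 1)) * deg u * g (p u)"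
      if u: "u \<in> V" for u
      using \<open>r \<ge> 2\<close> unfolding sum_nb[OF u] sV sA[OF assms(3)[OF u]] deg[OF u]
      by (simp add: field_simps)
    moreover obtain a where "a \<in> A 0"
      using cardA[of 0] assms(1,2) by fastforce
    ultimately show ?thesis
      unfolding norm_lap_eigenvalue_iff
      by (intro exI[of _ "\<lambda>u. g (p u)"]) (auto simp: A_def g_def intro!: bexI[of _ a])
  qed
  moreover have "1 \<in> norm_lap_eigenvalues V E"
  proof -
    have "\<not> card (A 0) \<le> Suc 0"
      using cardA[of 0] assms(1,2) by simp
    then obtain a b where ab: "a \<in> A 0" "b \<in> A 0" "a \<noteq> b"
      using card_le_Suc0_iff_eq[OF fin] by blast
    let ?y = "\<lambda>u. (if u = a then 1 else 0) - (if u = b then 1 else 0) :: real"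
    have "(\<Sum>w\<in>nbrs u. ?y w) = 0" if u: "u \<in> V" for u
      using ab AV by (simp add: sum_nb[OF u] sum_subtractf fin) (auto simp: A_def)
    then show ?thesis
      unfolding norm_lap_eigenvalue_iff using ab
      by (intro exI[of _ ?y]) (auto simp: A_def)
  qed
  moreover have "\<mu> \<in> {0, 1, real r / (real r - 1)}" if "\<mu> \<in> norm_lap_eigenvalues V E" for \<mu>
  proof -
    obtain y where y: "\<exists>u\<in>V. y u \<noteq> 0"
      "\<And>u. u \<in> V \<Longrightarrow> (\<Sum>w\<in>nbrs u. y w) = (1 - \<mu>) * deg u * y u"
      using \<open>\<mu> \<in> _\<close> by (auto simp: norm_lap_eigenvalue_iff)
    define \<nu> where "\<nu> = 1 - \<mu>"
    define Y where "Y = (\<Sum>w\<in>V. y w)"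
    define Z where "Z i = (\<Sum>w\<in>A i. y w)" for i
    have eq: "Y - Z (p u) = \<nu> * (real r - 1) * k * y u" if "u \<in> V" for u
      using y(2)[OF that] unfolding sum_nb[OF that] deg[OF that]
      by (simp add: Y_def Z_def \<nu>_def)
    have part_eq: "Y = (\<nu> * (real r - 1) + 1) * Z i" if "i < r" for i
    proof -
      have "(\<Sum>u\<in>A i. Y - Z i) = (\<Sum>u\<in>A i. \<nu> * (real r - 1) * k * y u)"
        using eq by (intro sum.cong) (auto simp: A_def)
      then have "k * (Y - Z i) = \<nu> * (real r - 1) * k * Z i"
        unfolding Z_def sum_distrib_left[symmetric] using cardA[OF that] by simp
      then have "real k * (Y - Z i) = real k * (\<nu> * (real r - 1) * Z i)"
        by (simp only: mult_ac)
      then have "Y - Z i = \<nu> * (real r - 1) * Z i"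
        using \<open>k \<ge> 2\<close> by (subst (asm) mult_cancel_left) simp
      then show ?thesis
        by (simp add: algebra_simps)
    qed
    \<comment> \<open>Summing over the parts gives an equation in \<open>Y\<close> alone, so
      \<open>Y\<close> vanishes unless \<nu> = 1.\<close>
    have "(\<Sum>i<r. Y) = (\<Sum>i<r. (\<nu> * (real r - 1) + 1) * Z i)"
      using part_eq by (intro sum.cong) auto
    then have "real r * Y = (\<nu> * (real r - 1) + 1) * Y"
      using sum_parts[of y] by (simp add: Y_def Z_def flip: sum_distrib_left)
    then have total: "(real r - 1) * (1 - \<nu>) * Y = 0"
      by (simp add: algebra_simps)
    have "\<nu> = 0 \<or> \<nu> = 1 \<or> \<nu> * (real r - 1) + 1 = 0"
    proof (rule ccontr)
      assume H: "\<not> ?thesis"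
      then have "Y = 0"
        using total \<open>r \<ge> 2\<close> by simp
      then have "Z i = 0" if "i < r" for i
        using part_eq[OF that] H by simp
      then have "y u = 0" if "u \<in> V" for u
        using eq[OF that] \<open>Y = 0\<close> H assms(1-3) that by simp
      then show False using y(1) by blast
    qed
    moreover have "\<mu> = real r / (real r - 1)" if "\<nu> * (real r - 1) + 1 = 0"
      using that \<open>r \<ge> 2\<close> by (simp add: \<nu>_def field_simps)
    ultimately show ?thesis by (auto simp: \<nu>_def)
  qed
  ultimately show ?thesis
    using zero_eigenvalue by blast
qed

end

section \<open>The equivalence, assembled from both directions\<close>

theorem theorem2p1:
  fixes V :: "'a set" and E :: "'a \<Rightarrow> 'a \<Rightarrow> bool" and n :: nat
  assumes "simple_graph V E" and "connected_graph V E"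
    and "n = card V" and "n \<ge> 3"
  shows "(card (norm_lap_eigenvalues V E) = 3 \<and> 1 \<in> norm_lap_eigenvalues V E) \<longleftrightarrow>
         ((\<exists>s. 1 \<le> s \<and> s \<le> n - 1 \<and>
              graph_iso V E (kmp_vertices 2 (\<lambda>i. if i = 0 then s else n - s))
                            (kmp_edges 2 (\<lambda>i. if i = 0 then s else n - s))) \<or>
          (\<exists>r k. 3 \<le> r \<and> r \<le> n - 1 \<and> r * k = n \<and>
              graph_iso V E (kmp_vertices r (\<lambda>_. k)) (kmp_edges r (\<lambda>_. k))))"
    (is "?spec \<longleftrightarrow> ?bip \<or> ?bal")
proof -
  interpret nontrivial_connected_graph V E
    using assms by unfold_locales auto
  have "?spec" if "?bip"
  proof -
    have "norm_lap_eigenvalues V E = {0, 1, 2}"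
      using that assms(3,4) complete_bipartite_eigenvalues
      unfolding graph_iso_kmp_iff[OF finite_V] by blast
    then show ?thesis by simp
  qed
  moreover have "?spec" if "?bal"
  proof -
    obtain r k p where *: "3 \<le> r" "r \<le> n - 1" "r * k = n" "\<forall>u\<in>V. p u < r"
      "\<forall>i<r. card {u \<in> V. p u = i} = k" "\<forall>u\<in>V. \<forall>v\<in>V. E u v \<longleftrightarrow> p u \<noteq> p v"
      using \<open>?bal\<close> unfolding graph_iso_kmp_iff[OF finite_V] by blast
    \<comment> \<open>k = 0 would give n = 0, and k = 1 would give r = n, against
      \<open>r \<le> n - 1\<close>.\<close>
    have "k \<noteq> 0" "k \<noteq> 1"
      using *(1-3) assms(4) by (intro notI; simp)+
    then have "norm_lap_eigenvalues V E = {0, 1, real r / (real r - 1)}"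
      using * by (intro balanced_multipartite_eigenvalues[of r k p]) auto
    moreover have "real r / (real r - 1) \<noteq> 0" "real r / (real r - 1) \<noteq> 1"
      using \<open>3 \<le> r\<close> by auto
    ultimately show ?thesis by auto
  qed
  moreover have "?bip \<or> ?bal" if "?spec"
    using three_eigenvalues_imp_multipartite that unfolding assms(3) by blast
  ultimately show ?thesis by blast
qed

end
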